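(* Let $\mathcal H$ be a complex infinite dimensional Hilbert space and let $A\in\mathcal B(\mathcal H)$. (1) There exists a unique pair of operators $A_1\in\mathcal B(\mathcal H)_I$ and $A_2\in\mathcal B(\mathcal H)_{II}$ such that $A_i\overset{*}{\leq}A$ for $i=1,2$ and $A=A_1+A_2$. (2) $A\in\mathcal B(\mathcal H)_I$ if and only if there exist a unique family of mutually orthogonal nonzero partial isometries $\{U_j:j\in J\}$ and a family of positive numbers $\{a_j:j\in J\}$ with $a_i\neq a_j$ for any $i,j\in J$, $i\neq j$, such that $$A=\sum_{j\in J}a_jU_j .$$
   Context: $\mathcal B(\mathcal H)$ is the algebra of all bounded linear operators on $\mathcal H$. The star order on $\mathcal B(\mathcal H)$: $A\overset{*}{\leq}B$ iff $A^*A=A^*B$ and $AA^*=BA^*$. For $x,y\in\mathcal H$, $x\otimes y$ denotes the operator $z\mapsto\langle z,y\rangle x$; it is a rank-1 operator when $x,y\ne 0$. Operators $A,B$ are orthogonal, $A\bot B$, if $A^*B=AB^*=0$. For $\mathcal A\subseteq\mathcal B(\mathcal H)$, an upper bound of $\mathcal A$ is an operator $B$ with $A\overset{*}{\leq}B$ for all $A\in\mathcal A$; the supremum $\sup\mathcal A$ is an upper bound $D$ such that $D\overset{*}{\leq}B$ for every upper bound $B$ of $\mathcal A$. $A$ is of type 1 if $A=0$ or $A=\sup\{x\otimes y:\ x\otimes y \text{ of rank 1},\ x\otimes y\overset{*}{\leq}A\}$; $A$ is of type 2 if there is no rank-1 operator $x\otimes y$ with $x\otimes y\overset{*}{\leq}A$.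 $\mathcal B(\mathcal H)_I$ and $\mathcal B(\mathcal H)_{II}$ denote the sets of all type 1 and all type 2 operators, respectively (so $0$ belongs to both). Sums over possibly infinite index sets are understood as unordered sums converging in the strong operator topology; the index set $J$ may be empty (when $A=0$). Uniqueness of the families in (2) is up to re-indexing. *)

theory Defs
  imports "HOL-Analysis.Analysis"
begin

section \<open>Complex Hilbert spaces\<close>

class complex_vector = real_vector +
  fixes scaleC :: "complex \<Rightarrow> 'a \<Rightarrow> 'a"  (infixr \<open>*\<^sub>C\<close> 75)
  assumes scaleC_add_right: "c *\<^sub>C (x + y) = c *\<^sub>C x + c *\<^sub>C y"
    and scaleC_add_left: "(c + d) *\<^sub>C x = c *\<^sub>C x + d *\<^sub>C x"
    and scaleC_scaleC: "c *\<^sub>C (d *\<^sub>C x) = (c * d) *\<^sub>C x"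
    and scaleC_one: "1 *\<^sub>C x = x"
    and scaleC_of_real: "complex_of_real r *\<^sub>C x = r *\<^sub>R x"

interpretation complex_vector: vector_space "scaleC :: complex \<Rightarrow> 'a \<Rightarrow> 'a::complex_vector"
  by unfold_locales
    (simp_all add: scaleC_add_right scaleC_add_left scaleC_scaleC scaleC_one)

text \<open>The inner product is linear in its first argument. The last axiom says that the
  norm is the one induced by the inner product; positive definiteness follows from it.\<close>

class complex_inner = complex_vector + real_normed_vector +
  fixes cinner :: "'a \<Rightarrow> 'a \<Rightarrow> complex"
  assumes cinner_commute: "cinner x y = cnj (cinner y x)"
    and cinner_add_left: "cinner (x + y) z = cinner x z + cinner y z"
    and cinner_scaleC_left: "cinner (c *\<^sub>C x) y = c * cinner x y"
    and cinner_self: "cinner x x = complex_of_real ((norm x)\<^sup>2)"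

class complex_hilbert = complex_inner + complete_space

lemma cinner_add_right: "cinner x (y + z) = cinner x y + cinner x (z::'a::complex_inner)"
  by (metis cinner_add_left cinner_commute complex_cnj_add)

lemma cinner_scaleC_right: "cinner x (c *\<^sub>C y) = cnj c * cinner x (y::'a::complex_inner)"
  by (metis cinner_scaleC_left cinner_commute complex_cnj_mult)

definition infinite_dimensional :: "'a::complex_vector itself \<Rightarrow> bool" where
  "infinite_dimensional _ \<longleftrightarrow> \<not> (\<exists>S::'a set. finite S \<and> complex_vector.span S = UNIV)"


section \<open>Bounded operators\<close>

typedef (overloaded) ('a::complex_inner) bop =
  "{f :: 'a \<Rightarrow> 'a. bounded_linear f \<and> (\<forall>c x. f (c *\<^sub>C x) = c *\<^sub>C f x)}"
  morphisms bop_apply Bop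
  by (rule exI[of _ "\<lambda>x. x"]) (simp add: bounded_linear_ident)

setup_lifting type_definition_bop

declare [[coercion bop_apply]]

instantiation bop :: (complex_inner) ab_group_add
begin

lift_definition zero_bop :: "'a bop" is "\<lambda>x. 0"
  by (simp add: bounded_linear_zero)

lift_definition plus_bop :: "'a bop \<Rightarrow> 'a bop \<Rightarrow> 'a bop" is "\<lambda>f g x. f x + g x"
  by (simp add: bounded_linear_add complex_vector.scale_right_distrib)

lift_definition uminus_bop :: "'a bop \<Rightarrow> 'a bop" is "\<lambda>f x. - f x"
  by (simp add: bounded_linear_minus)

lift_definition minus_bop :: "'a bop \<Rightarrow> 'a bop \<Rightarrow> 'a bop" is "\<lambda>f g x. f x - g x"
  by (simp add: bounded_linear_sub complex_vector.scale_right_diff_distrib)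

instance
  by standard (transfer; simp add: fun_eq_iff algebra_simps)+

end

lift_definition bop_comp :: "'a::complex_inner bop \<Rightarrow> 'a bop \<Rightarrow> 'a bop"  (infixl \<open>\<cdot>\<close> 70)
  is "\<lambda>f g x. f (g x)"
  by (simp add: bounded_linear_compose)

text \<open>On a Hilbert space, the operator described here exists by the Riesz representation
  theorem; it is unique because the inner product is definite.\<close>

definition bop_adj :: "'a::complex_hilbert bop \<Rightarrow> 'a bop" where
  "bop_adj A = (THE B :: 'a bop. \<forall>x y. cinner (A x) y = cinner x (B y))"

lemma cinner_Cauchy_Schwarz: "cmod (cinner x y) \<le> norm x * norm (y::'a::complex_inner)"
proof (cases "y = 0")
  case True
  have "cinner x (0::'a) = 0"
    using cinner_add_right[of x "0::'a" 0] by simp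
  with True show ?thesis by simp
next
  case False
  define n where "n = (norm y)\<^sup>2"
  have n: "n > 0" using False by (simp add: n_def)
  define c where "c = cinner x y / complex_of_real n"
  have "complex_of_real ((norm (x + (- c) *\<^sub>C y))\<^sup>2)
      = complex_of_real ((norm x)\<^sup>2 - (cmod (cinner x y))\<^sup>2 / n)"
  proof -
    have "cinner (x + (- c) *\<^sub>C y) (x + (- c) *\<^sub>C y)
        = cinner x x - c * cinner y x - cnj c * cinner x y + c * cnj c * cinner y y"
      by (simp only: cinner_add_left cinner_add_right cinner_scaleC_left cinner_scaleC_right)
        (simp add: algebra_simps)
    also have "c * cnj c * cinner y y = cnj c * cinner x y"
      using n by (simp add: c_def cinner_self[of y] n_def[symmetric])
    also have "c * cinner y x = complex_of_real ((cmod (cinner x y))\<^sup>2 / n)"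
      by (simp add: c_def cinner_commute[of y x] complex_norm_square del: of_real_power)
    finally show ?thesis by (simp add: cinner_self)
  qed
  then have "(norm (x + (- c) *\<^sub>C y))\<^sup>2 = (norm x)\<^sup>2 - (cmod (cinner x y))\<^sup>2 / n"
    by (simp only: of_real_eq_iff)
  then have "(cmod (cinner x y))\<^sup>2 / n \<le> (norm x)\<^sup>2"
    by (metis diff_ge_0_iff_ge zero_le_power2)
  then have "(cmod (cinner x y))\<^sup>2 \<le> (norm x * norm y)\<^sup>2"
    using n by (simp add: divide_le_eq n_def power_mult_distrib)
  then show ?thesis
    by (rule power2_le_imp_le) simp
qed

lemma norm_scaleC: "norm (c *\<^sub>C x) = cmod c * norm (x::'a::complex_inner)"
proof -
  have "complex_of_real ((norm (c *\<^sub>C x))\<^sup>2) = complex_of_real ((cmod c * norm x)\<^sup>2)"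
    by (simp only: cinner_self[symmetric] cinner_scaleC_left cinner_scaleC_right)
      (simp add: cinner_self power_mult_distrib complex_norm_square mult_ac
        del: of_real_power)
  then have "(norm (c *\<^sub>C x))\<^sup>2 = (cmod c * norm x)\<^sup>2"
    by (simp only: of_real_eq_iff)
  then show ?thesis
    by (simp add: power2_eq_iff_nonneg)
qed

lift_definition rank1 :: "'a::complex_inner \<Rightarrow> 'a \<Rightarrow> 'a bop"  (infix \<open>\<otimes>\<close> 72)
  is "\<lambda>x y z. cinner z y *\<^sub>C x"
proof (intro conjI allI)
  fix x y :: 'a
  show "bounded_linear (\<lambda>z. cinner z y *\<^sub>C x)"
  proof (rule bounded_linear_intro)
    show "norm (cinner z y *\<^sub>C x) \<le> norm z * (norm y * norm x)" for z
      using mult_right_mono[OF cinner_Cauchy_Schwarz[of z y] norm_ge_zero[of x]]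
      by (simp add: norm_scaleC mult.assoc)
  qed (simp_all add: cinner_add_left scaleC_add_left cinner_scaleC_left scaleC_scaleC
      flip: scaleC_of_real)
  show "cinner (c *\<^sub>C z) y *\<^sub>C x = c *\<^sub>C cinner z y *\<^sub>C x" for c z
    by (simp add: cinner_scaleC_left scaleC_scaleC)
qed

definition bop_orthogonal :: "'a::complex_hilbert bop \<Rightarrow> 'a bop \<Rightarrow> bool"  (infix \<open>\<bottom>\<close> 50) where
  "A \<bottom> B \<longleftrightarrow> bop_adj A \<cdot> B = 0 \<and> A \<cdot> bop_adj B = 0"

text \<open>Isometric on the orthogonal complement of its kernel.\<close>

definition partial_isometry :: "'a::complex_hilbert bop \<Rightarrow> bool" where
  "partial_isometry U \<longleftrightarrow>
    (\<forall>x. (\<forall>y. U y = 0 \<longrightarrow> cinner x y = 0) \<longrightarrow> norm (U x) = norm x)"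


section \<open>The star order\<close>

definition star_le :: "'a::complex_hilbert bop \<Rightarrow> 'a bop \<Rightarrow> bool"  (infix \<open>\<preceq>\<close> 50) where
  "A \<preceq> B \<longleftrightarrow> bop_adj A \<cdot> A = bop_adj A \<cdot> B \<and> A \<cdot> bop_adj A = B \<cdot> bop_adj A"

definition star_upper_bound :: "'a::complex_hilbert bop set \<Rightarrow> 'a bop \<Rightarrow> bool" where
  "star_upper_bound \<A> B \<longleftrightarrow> (\<forall>A\<in>\<A>. A \<preceq> B)"

definition is_star_sup :: "'a::complex_hilbert bop set \<Rightarrow> 'a bop \<Rightarrow> bool" where
  "is_star_sup \<A> D \<longleftrightarrow> star_upper_bound \<A> D \<and> (\<forall>B. star_upper_bound \<A> B \<longrightarrow> D \<preceq> B)"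

definition type1 :: "'a::complex_hilbert bop set" where
  "type1 = {A. A = 0 \<or> is_star_sup {x \<otimes> y | x y. x \<noteq> 0 \<and> y \<noteq> 0 \<and> x \<otimes> y \<preceq> A} A}"

definition type2 :: "'a::complex_hilbert bop set" where
  "type2 = {A. \<not> (\<exists>x y. x \<noteq> 0 \<and> y \<noteq> 0 \<and> x \<otimes> y \<preceq> A)}"

text \<open>\<open>A = (\<Sum>j\<in>J. a j U j)\<close>, an unordered sum converging in the strong operator topology,
  with mutually orthogonal nonzero partial isometries \<open>U j\<close> and pairwise distinct
  positive coefficients \<open>a j\<close>.\<close>

definition isometry_decomposition ::
    "'a::complex_hilbert bop \<Rightarrow> 'j set \<Rightarrow> ('j \<Rightarrow> 'a bop) \<Rightarrow> ('j \<Rightarrow> real) \<Rightarrow> bool" where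
  "isometry_decomposition A J U a \<longleftrightarrow>
    (\<forall>j\<in>J. partial_isometry (U j) \<and> U j \<noteq> 0 \<and> a j > 0) \<and>
    (\<forall>i\<in>J. \<forall>j\<in>J. i \<noteq> j \<longrightarrow> U i \<bottom> U j \<and> a i \<noteq> a j) \<and>
    (\<forall>x. ((\<lambda>j. a j *\<^sub>R U j x) has_sum A x) J)"

text \<open>In statements asserting that a decomposition exists, \<open>J\<close> may be taken to be a set of
  reals: \<open>a\<close> is injective on \<open>J\<close>, so every decomposition can be re-indexed by \<open>a ` J\<close>.\<close>

end

theory Submission
  imports Defs
begin

text \<open>
  For nonzero \<open>x\<close> and \<open>y\<close>, \<open>x \<otimes> y \<preceq> A\<close> means \<open>A y = \<parallel>y\<parallel>\<^sup>2 x\<close> and \<open>A\<^sup>* x = \<parallel>x\<parallel>\<^sup>2 y\<close>, so the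
  rank-1 operators below \<open>A\<close> correspond to the eigenvectors of \<open>A\<^sup>* A\<close> with eigenvalue \<open>a\<^sup>2 > 0\<close>.
  Let \<open>P\<close> project onto the closed span of these eigenvectors. Then \<open>A\<close> is of type 1 iff
  \<open>A P = A\<close>, and of type 2 iff there are no such eigenvectors; since \<open>P\<close> commutes with \<open>A\<^sup>* A\<close>,
  the parts of \<open>A\<close> are \<open>A P\<close> and \<open>A - A P\<close>. If \<open>P\<^sub>a\<close> projects onto the eigenspace for \<open>a\<^sup>2\<close>,
  then \<open>A P\<close> is the sum of the operators \<open>A P\<^sub>a = a U\<^sub>a\<close>. Conversely, in any decomposition
  \<open>A = \<Sum>\<^sub>k b\<^sub>k V\<^sub>k\<close> one has \<open>A\<^sup>* A V\<^sub>k\<^sup>* = b\<^sub>k\<^sup>2 V\<^sub>k\<^sup>*\<close>, which forces \<open>V\<^sub>k\<close> to be \<open>U\<^sub>a\<close> for \<open>a = b\<^sub>k\<close>. No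
  spectral theorem is needed.
\<close>

subsection \<open>Inner products and orthogonal projections\<close>

lemma cinner_zero_left [simp]: "cinner 0 (y::'a::complex_inner) = 0"
  using cinner_add_left[of 0 0 y] by simp

lemma cinner_zero_right [simp]: "cinner (x::'a::complex_inner) 0 = 0"
  using cinner_add_right[of x 0 0] by simp

lemma cinner_minus_left: "cinner (- x) (y::'a::complex_inner) = - cinner x y"
  using cinner_add_left[of x "- x" y] by (simp add: eq_neg_iff_add_eq_0 add.commute)

lemma cinner_minus_right: "cinner x (- y::'a::complex_inner) = - cinner x y"
  using cinner_add_right[of x y "- y"] by (simp add: eq_neg_iff_add_eq_0 add.commute)

lemma cinner_diff_left: "cinner (x - y) (z::'a::complex_inner) = cinner x z - cinner y z"
  using cinner_add_left[of x "- y" z] by (simp add: cinner_minus_left)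

lemma cinner_diff_right: "cinner z (x - y::'a::complex_inner) = cinner z x - cinner z y"
  using cinner_add_right[of z x "- y"] by (simp add: cinner_minus_right)

lemma cinner_scaleR_left: "cinner (r *\<^sub>R x) (y::'a::complex_inner) = of_real r * cinner x y"
  by (metis cinner_scaleC_left scaleC_of_real)

lemma cinner_scaleR_right: "cinner x (r *\<^sub>R y::'a::complex_inner) = of_real r * cinner x y"
  by (metis cinner_scaleC_right scaleC_of_real complex_cnj_complex_of_real)

lemma scaleC_scaleR_commute: "c *\<^sub>C (r *\<^sub>R x) = r *\<^sub>R (c *\<^sub>C (x::'a::complex_vector))"
  by (simp flip: scaleC_of_real add: scaleC_scaleC mult.commute)

lemma cinner_sum_left: "cinner (\<Sum>i\<in>I. f i) (y::'a::complex_inner) = (\<Sum>i\<in>I. cinner (f i) y)"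
  by (induction I rule: infinite_finite_induct) (simp_all add: cinner_add_left)

lemma cinner_self_eq_0 [simp]: "cinner x x = 0 \<longleftrightarrow> (x::'a::complex_inner) = 0"
  by (simp add: cinner_self del: of_real_power)

lemma cinner_eq_0_sym: "cinner x y = 0 \<longleftrightarrow> cinner y (x::'a::complex_inner) = 0"
  by (metis cinner_commute complex_cnj_zero)

lemma cinner_ext_left:
  assumes "\<And>z. cinner x z = cinner (y::'a::complex_inner) z"
  shows "x = y"
  using assms[of "x - y"] cinner_self_eq_0[of "x - y"] by (simp add: cinner_diff_left)

lemma cinner_ext_right:
  assumes "\<And>z. cinner z x = cinner z (y::'a::complex_inner)"
  shows "x = y"
  using assms[of "x - y"] cinner_self_eq_0[of "x - y"] by (simp add: cinner_diff_right)

lemma norm_add_square: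
  "(norm (x + y))\<^sup>2 = (norm x)\<^sup>2 + 2 * Re (cinner x y) + (norm (y::'a::complex_inner))\<^sup>2"
proof -
  have "complex_of_real ((norm (x + y))\<^sup>2)
      = complex_of_real ((norm x)\<^sup>2) + (cinner x y + cnj (cinner x y)) + complex_of_real ((norm y)\<^sup>2)"
    by (simp only: cinner_self[symmetric] cinner_commute[of y x, symmetric])
      (simp add: cinner_add_left cinner_add_right)
  also have "\<dots> = complex_of_real ((norm x)\<^sup>2 + 2 * Re (cinner x y) + (norm y)\<^sup>2)"
    by (simp add: complex_add_cnj)
  finally show ?thesis
    by (simp only: of_real_eq_iff)
qed

lemma norm_diff_square:
  "(norm (x - y))\<^sup>2 = (norm x)\<^sup>2 - 2 * Re (cinner x y) + (norm (y::'a::complex_inner))\<^sup>2"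
  using norm_add_square[of x "- y"] by (simp add: cinner_minus_right)

lemma bounded_linear_cinner_left: "bounded_linear (\<lambda>x. cinner x (y::'a::complex_inner))"
  by (rule bounded_linear_intro[where K = "norm y"])
    (simp_all add: cinner_add_left cinner_scaleR_left cinner_Cauchy_Schwarz scaleR_conv_of_real)

lemma closed_cinner_eq_0: "closed {x. cinner x (y::'a::complex_inner) = 0}"
  by (intro closed_Collect_eq linear_continuous_on bounded_linear_cinner_left continuous_on_const)

lemma subspace_cinner_eq_0: "complex_vector.subspace {x. cinner x (y::'a::complex_inner) = 0}"
  by (rule complex_vector.subspaceI) (simp_all add: cinner_add_left cinner_scaleC_left)

section \<open>Closed linear spans\<close>

lemma closure_span_minimal:
  assumes "complex_vector.subspace S" "closed S" "X \<subseteq> S" "x \<in> closure (complex_vector.span X)"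
  shows "x \<in> (S::'a::complex_inner set)"
  using assms by (meson closure_minimal complex_vector.span_minimal in_mono)

lemma subspace_closure_span:
  "complex_vector.subspace (closure (complex_vector.span (X::'a::complex_inner set)))"
proof (rule complex_vector.subspaceI)
  show "0 \<in> closure (complex_vector.span X)"
    using closure_subset complex_vector.span_zero by blast
next
  fix x y assume "x \<in> closure (complex_vector.span X)" "y \<in> closure (complex_vector.span X)"
  then obtain f g where "\<forall>n. f n \<in> complex_vector.span X" "f \<longlonglongrightarrow> x"
      "\<forall>n. g n \<in> complex_vector.span X" "g \<longlonglongrightarrow> y"
    unfolding closure_sequential by blast
  then show "x + y \<in> closure (complex_vector.span X)"
    unfolding closure_sequential
    by (intro exI[of _ "\<lambda>n. f n + g n"]) (auto intro: complex_vector.span_add tendsto_add)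
next
  fix c x assume "x \<in> closure (complex_vector.span X)"
  then obtain f where f: "\<forall>n. f n \<in> complex_vector.span X" "f \<longlonglongrightarrow> x"
    unfolding closure_sequential by blast
  have "bounded_linear (\<lambda>x::'a. c *\<^sub>C x)"
    by (rule bounded_linear_intro[where K = "cmod c"])
      (simp_all add: scaleC_add_right scaleC_scaleR_commute norm_scaleC)
  then have "(\<lambda>n. c *\<^sub>C f n) \<longlonglongrightarrow> c *\<^sub>C x"
    using f(2) by (rule bounded_linear.tendsto)
  then show "c *\<^sub>C x \<in> closure (complex_vector.span X)"
    unfolding closure_sequential using f(1)
    by (intro exI[of _ "\<lambda>n. c *\<^sub>C f n"]) (auto intro: complex_vector.span_scale)
qed

section \<open>The projection theorem for closed subspaces\<close>

text \<open>By the parallelogram law a minimizing sequence in \<open>S\<close> is Cauchy, and its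
  limit stays in \<open>S\<close> by closedness.\<close>

lemma ex_closest_point:
  fixes x :: "'a::complex_hilbert"
  assumes S: "complex_vector.subspace S" "closed S"
  obtains p where "p \<in> S" "\<And>s. s \<in> S \<Longrightarrow> norm (x - p) \<le> norm (x - s)"
proof -
  define D where "D = (INF s\<in>S. (norm (x - s))\<^sup>2)"
  have ne: "S \<noteq> {}"
    using complex_vector.subspace_0[OF S(1)] by blast
  have bdd: "bdd_below ((\<lambda>s. (norm (x - s))\<^sup>2) ` S)"
    by (rule bdd_belowI2[of _ 0]) simp
  have D: "D \<le> (norm (x - s))\<^sup>2" if "s \<in> S" for s
    unfolding D_def using that bdd by (rule cINF_lower[rotated])
  have "\<exists>s\<in>S. (norm (x - s))\<^sup>2 < D + 1 / real (Suc n)" for n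
    using cINF_less_iff[OF ne bdd, of "D + 1 / real (Suc n)"] by (simp add: D_def)
  then obtain f where f: "\<And>n. f n \<in> S" "\<And>n. (norm (x - f n))\<^sup>2 < D + 1 / real (Suc n)"
    by metis
  have fdiff: "(norm (f m - f n))\<^sup>2 \<le> 2 / real (Suc m) + 2 / real (Suc n)" for m n
  proof -
    \<comment> \<open>The midpoint has squared distance at least \<open>D\<close> from
      \<open>x\<close>; four times this cancels all but the error terms in the parallelogram
      law.\<close>
    have mid: "(1/2) *\<^sub>R (f m + f n) \<in> S"
      by (metis S(1) complex_vector.subspace_add complex_vector.subspace_scale f(1) scaleC_of_real)
    have "(norm (f m - f n))\<^sup>2 + (norm ((x - f m) + (x - f n)))\<^sup>2
        = 2 * (norm (x - f m))\<^sup>2 + 2 * (norm (x - f n))\<^sup>2"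
      using norm_add_square[of "x - f m" "x - f n"] norm_diff_square[of "x - f n" "x - f m"]
        cinner_commute[of "x - f n" "x - f m"] by simp
    moreover have "(x - f m) + (x - f n) = 2 *\<^sub>R (x - (1/2) *\<^sub>R (f m + f n))"
      by (simp add: algebra_simps scaleR_2)
    then have "(norm ((x - f m) + (x - f n)))\<^sup>2 = 4 * (norm (x - (1/2) *\<^sub>R (f m + f n)))\<^sup>2"
      by (simp add: power_mult_distrib)
    ultimately show ?thesis
      using D[OF mid] f(2)[of m] f(2)[of n] by simp
  qed
  have "Cauchy f"
  proof (rule CauchyI)
    fix e :: real assume e: "e > 0"
    obtain N where N: "1 / real (Suc N) < e\<^sup>2 / 4"
      using reals_Archimedean[of "e\<^sup>2 / 4"] e by (auto simp: inverse_eq_divide)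
    have "norm (f m - f n) < e" if "m \<ge> N" "n \<ge> N" for m n
    proof -
      have "1 / real (Suc m) \<le> 1 / real (Suc N)" "1 / real (Suc n) \<le> 1 / real (Suc N)"
        using that by (simp_all add: frac_le)
      then have "(norm (f m - f n))\<^sup>2 < e\<^sup>2"
        using fdiff[of m n] N by simp
      then show ?thesis
        using e by (simp add: power2_less_imp_less)
    qed
    then show "\<exists>M. \<forall>m\<ge>M. \<forall>n\<ge>M. norm (f m - f n) < e" by blast
  qed
  then obtain p where p: "f \<longlonglongrightarrow> p"
    by (metis Cauchy_convergent_iff convergent_def)
  have "p \<in> S"
    using closed_sequentially[OF S(2)] f(1) p by blast
  moreover have "norm (x - p) \<le> norm (x - s)" if "s \<in> S" for s
  proof -
    have "(\<lambda>n. (norm (x - f n))\<^sup>2) \<longlonglongrightarrow> (norm (x - p))\<^sup>2"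
      by (intro tendsto_intros p)
    moreover have "(\<lambda>n. D + 1 / real (Suc n)) \<longlonglongrightarrow> D + 0"
      by (intro tendsto_intros LIMSEQ_inverse_real_of_nat[unfolded inverse_eq_divide])
    ultimately have "(norm (x - p))\<^sup>2 \<le> D + 0"
      by (rule LIMSEQ_le) (use f(2) less_imp_le in blast)
    then have "(norm (x - p))\<^sup>2 \<le> (norm (x - s))\<^sup>2"
      using D[OF that] by linarith
    then show ?thesis
      by (rule power2_le_imp_le) simp
  qed
  ultimately show ?thesis using that by blast
qed

lemma ex_orthogonal_decomposition:
  fixes x :: "'a::complex_hilbert"
  assumes S: "complex_vector.subspace S" "closed S"
  shows "\<exists>p\<in>S. \<forall>s\<in>S. cinner (x - p) s = 0"
proof -
  obtain p where p: "p \<in> S" "\<And>s. s \<in> S \<Longrightarrow> norm (x - p) \<le> norm (x - s)"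
    using ex_closest_point[OF S] by blast
  have "cinner (x - p) s = 0" if s: "s \<in> S" for s
  proof (cases "s = 0")
    case False
    define n where "n = (norm s)\<^sup>2"
    have n: "n > 0" using False by (simp add: n_def)
    \<comment> \<open>\<open>c *\<^sub>C s\<close> is the component of \<open>x - p\<close> along
      \<open>s\<close>. Moving \<open>p\<close> by it would lower the squared distance by
      \<open>(cmod c)\<^sup>2 * n\<close>, so minimality forces \<open>c = 0\<close>.\<close>
    define c where "c = cinner (x - p) s / of_real n"
    have "p + c *\<^sub>C s \<in> S"
      using S(1) p(1) s complex_vector.subspace_add complex_vector.subspace_scale by blast
    then have "norm (x - p) \<le> norm (x - p - c *\<^sub>C s)"
      using p(2) by (simp add: diff_diff_eq)
    then have "(norm (x - p))\<^sup>2 \<le> (norm (x - p - c *\<^sub>C s))\<^sup>2"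
      by (simp add: power_mono)
    also have "\<dots> = (norm (x - p))\<^sup>2 - 2 * Re (cnj c * cinner (x - p) s) + (cmod c)\<^sup>2 * n"
      by (simp add: norm_diff_square cinner_scaleC_right norm_scaleC power_mult_distrib n_def)
    also have "cinner (x - p) s = c * of_real n"
      using n by (simp add: c_def)
    also have "cnj c * (c * of_real n) = of_real ((cmod c)\<^sup>2 * n)"
      by (simp only: of_real_mult complex_norm_square mult_ac)
    finally have "(cmod c)\<^sup>2 * n \<le> 0"
      unfolding Re_complex_of_real by linarith
    then have "c = 0"
      using n by (simp add: mult_le_0_iff)
    then show ?thesis
      using n by (simp add: c_def)
  qed simp
  with p(1) show ?thesis by blast
qed

lemma orthogonal_decomposition_unique:
  fixes x :: "'a::complex_inner"
  assumes "complex_vector.subspace S" "p \<in> S" "q \<in> S"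
    and p: "\<And>s. s \<in> S \<Longrightarrow> cinner (x - p) s = 0" and q: "\<And>s. s \<in> S \<Longrightarrow> cinner (x - q) s = 0"
  shows "p = q"
proof -
  have "q - p \<in> S"
    using assms(1-3) complex_vector.subspace_diff by blast
  then have "cinner ((x - p) - (x - q)) (q - p) = 0"
    unfolding cinner_diff_left[of "x - p"] using p q by simp
  moreover have "(x - p) - (x - q) = q - p"
    by simp
  ultimately have "cinner (q - p) (q - p) = 0"
    by (simp only:)
  then show ?thesis
    unfolding cinner_self_eq_0 by simp
qed

subsection \<open>Adjoints\<close>

lemma bounded_linear_bop: "bounded_linear (bop_apply A)"
  using bop_apply by blast

lemma bop_scaleC: "A (c *\<^sub>C x) = c *\<^sub>C A x" for A :: "'a::complex_inner bop"
  using bop_apply by blast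

lemmas bop_add = linear_add[OF bounded_linear.linear[OF bounded_linear_bop]]
lemmas bop_diff = linear_diff[OF bounded_linear.linear[OF bounded_linear_bop]]
lemmas bop_0 [simp] = linear_0[OF bounded_linear.linear[OF bounded_linear_bop]]
lemmas bop_scaleR = linear_scale[OF bounded_linear.linear[OF bounded_linear_bop]]

lemma bop_eqI: "(\<And>x. A x = B x) \<Longrightarrow> A = B" for A B :: "'a::complex_inner bop"
  by (metis bop_apply_inject ext)

lemma bop_eq_iff: "A = B \<longleftrightarrow> (\<forall>x. A x = B x)" for A B :: "'a::complex_inner bop"
  using bop_eqI by auto

lemma bop_comp_apply [simp]: "(A \<cdot> B) x = A (B x)"
  by transfer simp

lemma zero_bop_apply [simp]: "(0 :: 'a::complex_inner bop) x = 0"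
  by transfer simp

lemma plus_bop_apply [simp]: "(A + B) x = A x + B x" for A B :: "'a::complex_inner bop"
  by transfer simp

lemma minus_bop_apply [simp]: "(A - B) x = A x - B x" for A B :: "'a::complex_inner bop"
  by transfer simp

lemma rank1_apply [simp]: "(x \<otimes> y) z = cinner z y *\<^sub>C x"
  by transfer simp

lemma closed_Collect_bop_eq: "closed {x. A x = B x}" for A B :: "'a::complex_inner bop"
  by (intro closed_Collect_eq linear_continuous_on bounded_linear_bop)

lemma subspace_Collect_bop_eq: "complex_vector.subspace {x. A x = B x}"
  for A B :: "'a::complex_inner bop"
  by (rule complex_vector.subspaceI) (simp_all add: bop_add bop_scaleC)

section \<open>Riesz representation and existence of adjoints\<close>

text \<open>A vector \<open>z\<close> orthogonal to the kernel of a nonzero \<open>f\<close>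
  represents \<open>f\<close> up to a scalar, because
  \<open>f x *\<^sub>C z - f z *\<^sub>C x\<close> always lies in that kernel.\<close>

lemma riesz:
  fixes f :: "'a::complex_hilbert \<Rightarrow> complex"
  assumes f: "bounded_linear f" "\<And>c x. f (c *\<^sub>C x) = c * f x"
  obtains y where "\<And>x. f x = cinner x y"
proof (cases "\<forall>x. f x = 0")
  case True
  then show ?thesis using that[of 0] by simp
next
  case False
  then obtain x0 where x0: "f x0 \<noteq> 0" by blast
  have add: "f (x + y) = f x + f y" "f (x - y) = f x - f y" for x y
    by (simp_all add: f(1) bounded_linear.linear linear_add linear_diff)
  have "f 0 = 0"
    by (simp add: f(1) bounded_linear.linear linear_0)
  then have "complex_vector.subspace {x. f x = 0}"
    by (intro complex_vector.subspaceI) (simp_all add: add f(2))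
  moreover have "closed {x. f x = 0}"
    by (intro closed_Collect_eq linear_continuous_on f(1) continuous_on_const)
  ultimately obtain p where p: "f p = 0" "\<And>s. f s = 0 \<Longrightarrow> cinner (x0 - p) s = 0"
    using ex_orthogonal_decomposition[of "{x. f x = 0}" x0] by auto
  define z where "z = x0 - p"
  have fz: "f z \<noteq> 0"
    using x0 p(1) by (simp add: z_def add)
  with \<open>f 0 = 0\<close> have z0: "z \<noteq> 0" by blast
  have "f x = cinner x ((cnj (f z) / cinner z z) *\<^sub>C z)" for x
  proof -
    have "f (f x *\<^sub>C z - f z *\<^sub>C x) = 0"
      by (simp add: add f(2))
    then have "cinner z (f x *\<^sub>C z - f z *\<^sub>C x) = 0"
      using p(2) by (simp add: z_def)
    then have "cinner (f x *\<^sub>C z - f z *\<^sub>C x) z = 0"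
      by (simp add: cinner_eq_0_sym)
    then have "f x * cinner z z = f z * cinner x z"
      by (simp add: cinner_diff_left cinner_scaleC_left)
    moreover have "cnj (cinner z z) = cinner z z"
      by (metis cinner_commute)
    ultimately show ?thesis
      using z0 by (simp add: cinner_scaleC_right field_simps)
  qed
  then show ?thesis using that by blast
qed

text \<open>Riesz defines \<open>B y\<close> separately for each \<open>y\<close>. Uniqueness of
  representing vectors makes the result linear, and Cauchy-Schwarz transfers the bound of
  \<open>A\<close> to it.\<close>

lemma ex_adjoint:
  fixes A :: "'a::complex_hilbert bop"
  obtains B :: "'a bop" where "\<And>x y. cinner (A x) y = cinner x (B y)"
proof -
  have "\<exists>z. \<forall>x. cinner (A x) y = cinner x z" for y
  proof -
    have "bounded_linear (\<lambda>x. cinner (A x) y)"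
      by (rule bounded_linear_compose[OF bounded_linear_cinner_left bounded_linear_bop])
    then show ?thesis
      by (rule riesz) (auto simp: bop_scaleC cinner_scaleC_left)
  qed
  then obtain g where g: "\<And>x y. cinner (A x) y = cinner x (g y)"
    by metis
  have add: "g (x + y) = g x + g y" for x y
    by (rule cinner_ext_right) (simp add: cinner_add_right flip: g)
  have scaleC: "g (c *\<^sub>C x) = c *\<^sub>C g x" for c x
    by (rule cinner_ext_right) (simp add: cinner_scaleC_right flip: g)
  obtain K where K: "K > 0" "\<And>x. norm (A x) \<le> norm x * K"
    using bounded_linear.pos_bounded[OF bounded_linear_bop] by blast
  have bound: "norm (g y) \<le> norm y * K" for y
  proof (cases "g y = 0")
    case False
    have "norm (g y) * norm (g y) = cmod (cinner (g y) (g y))"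
      by (simp add: cinner_self power2_eq_square norm_mult)
    also have "\<dots> = cmod (cinner (A (g y)) y)"
      by (simp add: g)
    also have "\<dots> \<le> norm (A (g y)) * norm y"
      by (rule cinner_Cauchy_Schwarz)
    also have "\<dots> \<le> norm (g y) * K * norm y"
      using K(2) by (simp add: mult_right_mono)
    finally show ?thesis
      using False by (simp add: mult.assoc mult.commute)
  qed (use K(1) in simp)
  have "bounded_linear g"
    using add scaleC bound
    by (intro bounded_linear_intro[where K = K]) (simp_all flip: scaleC_of_real)
  then have "bop_apply (Bop g) = g"
    using scaleC by (intro Bop_inverse) blast
  then show ?thesis
    using that[of "Bop g"] g by simp
qed

lemma cinner_adj: "cinner (A x) y = cinner x (bop_adj A y)" for A :: "'a::complex_hilbert bop"
proof -
  have "\<exists>!B :: 'a bop. \<forall>x y. cinner (A x) y = cinner x (B y)"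
    using ex_adjoint[of A] by (metis bop_eqI cinner_ext_right)
  from theI'[OF this] show ?thesis
    unfolding bop_adj_def by blast
qed

lemma cinner_adj': "cinner x (A y) = cinner (bop_adj A x) y" for A :: "'a::complex_hilbert bop"
  by (metis cinner_adj cinner_commute)

lemma adj_eqI:
  fixes A B :: "'a::complex_hilbert bop"
  assumes "\<And>x y. cinner (A x) y = cinner x (B y)"
  shows "bop_adj A = B"
  by (metis assms bop_eqI cinner_adj cinner_ext_right)

lemma adj_adj [simp]: "bop_adj (bop_adj A) = A"
  by (rule adj_eqI) (simp add: cinner_adj')

lemma adj_comp [simp]: "bop_adj (A \<cdot> B) = bop_adj B \<cdot> bop_adj A"
  by (rule adj_eqI) (simp add: cinner_adj)

lemma adj_diff: "bop_adj (A - B) = bop_adj A - bop_adj B"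
  by (rule adj_eqI) (simp add: cinner_adj cinner_diff_left cinner_diff_right)

lemma adj_add: "bop_adj (A + B) = bop_adj A + bop_adj B"
  by (rule adj_eqI) (simp add: cinner_adj cinner_add_left cinner_add_right)

lemma adj_zero [simp]: "bop_adj 0 = 0"
  by (rule adj_eqI) simp

lemma adj_rank1 [simp]: "bop_adj (x \<otimes> y) = y \<otimes> x"
  by (rule adj_eqI)
    (metis cinner_commute cinner_scaleC_left cinner_scaleC_right mult.commute rank1_apply)

text \<open>\<open>cinner (A x) (A x) = cinner x (bop_adj A (A x))\<close>.\<close>

lemma adj_apply_apply_eq_0 [simp]: "bop_adj A (A x) = 0 \<longleftrightarrow> A x = 0"
  by (metis bop_0 cinner_adj cinner_self_eq_0 cinner_zero_right)

lemma adj_eq_0_iff [simp]: "bop_adj A = 0 \<longleftrightarrow> A = 0"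
  by (metis adj_adj adj_zero)

lift_definition bop_scaleR :: "real \<Rightarrow> 'a::complex_inner bop \<Rightarrow> 'a bop" is "\<lambda>r f x. r *\<^sub>R f x"
  by (simp add: bounded_linear_scaleR_right bounded_linear_compose scaleC_scaleR_commute)

lemma bop_scaleR_apply [simp]: "bop_scaleR r A x = r *\<^sub>R A x"
  by transfer simp

lemma adj_scaleR [simp]: "bop_adj (bop_scaleR r A) = bop_scaleR r (bop_adj A)"
  by (rule adj_eqI) (simp add: cinner_scaleR_left cinner_scaleR_right cinner_adj)

subsection \<open>Projection operators\<close>

text \<open>Uniqueness of the orthogonal decomposition makes the chosen map linear, and Pythagoras
  bounds it by 1.\<close>

lemma ex_projection:
  fixes S :: "'a::complex_hilbert set"
  assumes S: "complex_vector.subspace S" "closed S"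
  shows "\<exists>P :: 'a bop. \<forall>x. P x \<in> S \<and> (\<forall>s\<in>S. cinner (x - P x) s = 0)"
proof -
  have "\<exists>p. p \<in> S \<and> (\<forall>s\<in>S. cinner (x - p) s = 0)" for x
    using ex_orthogonal_decomposition[OF S, of x] by blast
  then obtain g where g: "\<And>x. g x \<in> S" "\<And>x s. s \<in> S \<Longrightarrow> cinner (x - g x) s = 0"
    by metis
  have uniq: "g x = p" if "p \<in> S" "\<And>s. s \<in> S \<Longrightarrow> cinner (x - p) s = 0" for x p
    using orthogonal_decomposition_unique[OF S(1) g(1) that(1) g(2) that(2)] by simp
  have add: "g (x + y) = g x + g y" for x y
  proof (rule uniq)
    show "g x + g y \<in> S"
      using S(1) g(1) complex_vector.subspace_add by blast
    show "cinner (x + y - (g x + g y)) s = 0" if "s \<in> S" for s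
      using g(2)[OF that, of x] g(2)[OF that, of y]
      by (simp add: cinner_diff_left cinner_add_left)
  qed
  have scaleC: "g (c *\<^sub>C x) = c *\<^sub>C g x" for c x
  proof (rule uniq)
    show "c *\<^sub>C g x \<in> S"
      using S(1) g(1) complex_vector.subspace_scale by blast
    show "cinner (c *\<^sub>C x - c *\<^sub>C g x) s = 0" if "s \<in> S" for s
      using g(2)[OF that, of x] by (simp add: cinner_diff_left cinner_scaleC_left)
  qed
  have bound: "norm (g x) \<le> norm x * 1" for x
  proof -
    have "(norm ((x - g x) + g x))\<^sup>2 = (norm (x - g x))\<^sup>2 + (norm (g x))\<^sup>2"
      using g by (simp only: norm_add_square) simp
    then have "(norm (g x))\<^sup>2 \<le> (norm x)\<^sup>2" by simp
    then show ?thesis by (simp add: power2_le_iff_abs_le)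
  qed
  have "bounded_linear g"
    using add scaleC bound
    by (intro bounded_linear_intro[where K = 1]) (simp_all flip: scaleC_of_real)
  then have "bop_apply (Bop g) = g"
    using scaleC by (intro Bop_inverse) blast
  then show ?thesis
    using g by (intro exI[of _ "Bop g"]) simp
qed

definition projection :: "'a::complex_hilbert set \<Rightarrow> 'a bop" where
  "projection S = (SOME P :: 'a bop. \<forall>x. P x \<in> S \<and> (\<forall>s\<in>S. cinner (x - P x) s = 0))"

text \<open>Interpreted below for eigenspaces, for their closed span and for kernels; in each case
  the choice in \<open>projection\<close> is justified by \<open>ex_projection\<close>.\<close>

locale closed_subspace =
  fixes S :: "'a::complex_hilbert set"
  assumes subspace: "complex_vector.subspace S" and closed: "closed S"
begin

lemma projection_in: "projection S x \<in> S"
  and cinner_projection: "s \<in> S \<Longrightarrow> cinner (x - projection S x) s = 0"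
  using someI_ex[OF ex_projection[OF subspace closed]] unfolding projection_def by blast+

lemma projection_eqI:
  assumes "p \<in> S" "\<And>s. s \<in> S \<Longrightarrow> cinner (x - p) s = 0"
  shows "projection S x = p"
  using orthogonal_decomposition_unique[OF subspace projection_in assms(1) cinner_projection assms(2)]
  by simp

lemma projection_ident: "x \<in> S \<Longrightarrow> projection S x = x"
  by (rule projection_eqI) simp_all

lemma projection_eq_0: "(\<And>s. s \<in> S \<Longrightarrow> cinner x s = 0) \<Longrightarrow> projection S x = 0"
  by (rule projection_eqI) (simp_all add: complex_vector.subspace_0[OF subspace])

lemma adj_projection [simp]: "bop_adj (projection S) = projection S"
proof (rule adj_eqI)
  fix x y
  have "cinner (projection S x) (y - projection S y) = 0"
    using cinner_projection projection_in cinner_eq_0_sym by blast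
  moreover have "cinner (x - projection S x) (projection S y) = 0"
    using cinner_projection projection_in by blast
  ultimately show "cinner (projection S x) y = cinner x (projection S y)"
    by (simp add: cinner_diff_left cinner_diff_right)
qed

lemma projection_idem [simp]: "projection S (projection S x) = projection S x"
  by (simp add: projection_ident projection_in)

text \<open>Self-adjointness gives \<open>T\<close> the orthogonal complement of \<open>S\<close> as
  a second invariant subspace.\<close>

lemma projection_commute:
  assumes adj: "bop_adj T = T" and inv: "\<And>s. s \<in> S \<Longrightarrow> T s \<in> S"
  shows "projection S (T x) = T (projection S x)"
proof (rule projection_eqI)
  show "T (projection S x) \<in> S"
    using inv projection_in by blast
  show "cinner (T x - T (projection S x)) s = 0" if "s \<in> S" for s
    using cinner_projection[OF inv[OF that]] cinner_adj[of T] adj by (metis bop_diff)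
qed

end

subsection \<open>The star order and orthogonality\<close>

lemma orthogonalD:
  assumes "A \<bottom> B"
  shows "bop_adj A (B x) = 0" "A (bop_adj B x) = 0" "bop_adj B (A x) = 0" "B (bop_adj A x) = 0"
proof -
  have eq: "bop_adj A \<cdot> B = 0" "A \<cdot> bop_adj B = 0"
    using assms by (simp_all add: bop_orthogonal_def)
  then have "bop_adj (bop_adj A \<cdot> B) = 0" "bop_adj (A \<cdot> bop_adj B) = 0"
    by simp_all
  with eq show "bop_adj A (B x) = 0" "A (bop_adj B x) = 0" "bop_adj B (A x) = 0" "B (bop_adj A x) = 0"
    by (simp_all add: bop_eq_iff)
qed

lemma orthogonal_sym:
  assumes "A \<bottom> B"
  shows "B \<bottom> A"
  unfolding bop_orthogonal_def bop_eq_iff by (simp add: orthogonalD[OF assms])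

lemma star_le_iff:
  "A \<preceq> B \<longleftrightarrow> (\<forall>x. bop_adj A (A x) = bop_adj A (B x)) \<and> (\<forall>x. A (bop_adj A x) = B (bop_adj A x))"
  by (simp add: star_le_def bop_eq_iff)

text \<open>The second equation of the star order is the adjoint of the second orthogonality
  equation. As orthogonality is symmetric, the complement \<open>B - A\<close> of a part of
  \<open>B\<close> is again below \<open>B\<close>.\<close>

lemma star_le_iff_orthogonal: "A \<preceq> B \<longleftrightarrow> A \<bottom> (B - A)"
proof -
  have "A \<cdot> bop_adj (B - A) = 0 \<longleftrightarrow> bop_adj (A \<cdot> bop_adj (B - A)) = 0"
    by (simp del: adj_comp)
  also have "\<dots> \<longleftrightarrow> (\<forall>x. A (bop_adj A x) = B (bop_adj A x))"
    by (auto simp: bop_eq_iff)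
  finally show ?thesis
    by (auto simp: star_le_iff bop_orthogonal_def bop_eq_iff bop_diff)
qed

lemma star_le_diff: "A \<preceq> B \<Longrightarrow> B - A \<preceq> B"
  by (simp add: star_le_iff_orthogonal orthogonal_sym)

text \<open>The equations of the star order compare \<open>(norm x)\<^sup>2\<close> times
  \<open>y \<otimes> y\<close> with \<open>y \<otimes> bop_adj A x\<close>, and
  \<open>(norm y)\<^sup>2\<close> times \<open>x \<otimes> x\<close> with
  \<open>A y \<otimes> x\<close>; the common factor can be cancelled.\<close>

lemma rank1_star_le_iff:
  fixes A :: "'a::complex_hilbert bop"
  assumes "x \<noteq> 0" "y \<noteq> 0"
  shows "x \<otimes> y \<preceq> A \<longleftrightarrow> A y = (norm y)\<^sup>2 *\<^sub>R x \<and> bop_adj A x = (norm x)\<^sup>2 *\<^sub>R y"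
proof -
  have "(\<forall>z. bop_adj (x \<otimes> y) ((x \<otimes> y) z) = bop_adj (x \<otimes> y) (A z))
      \<longleftrightarrow> (\<forall>z. cinner z ((norm x)\<^sup>2 *\<^sub>R y) = cinner z (bop_adj A x))"
    using assms by (simp add: cinner_scaleC_left cinner_self cinner_adj cinner_scaleR_right mult.commute)
  also have "\<dots> \<longleftrightarrow> bop_adj A x = (norm x)\<^sup>2 *\<^sub>R y"
    by (metis cinner_ext_right)
  finally have 1: "(\<forall>z. bop_adj (x \<otimes> y) ((x \<otimes> y) z) = bop_adj (x \<otimes> y) (A z))
      \<longleftrightarrow> bop_adj A x = (norm x)\<^sup>2 *\<^sub>R y" .
  have "(\<forall>z. (x \<otimes> y) (bop_adj (x \<otimes> y) z) = A (bop_adj (x \<otimes> y) z))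
      \<longleftrightarrow> (\<forall>z. cinner z x *\<^sub>C (norm y)\<^sup>2 *\<^sub>R x = cinner z x *\<^sub>C A y)"
    by (simp add: cinner_scaleC_left cinner_self bop_scaleC scaleC_scaleC flip: scaleC_of_real)
  also have "\<dots> \<longleftrightarrow> A y = (norm y)\<^sup>2 *\<^sub>R x"
  proof
    assume "\<forall>z. cinner z x *\<^sub>C (norm y)\<^sup>2 *\<^sub>R x = cinner z x *\<^sub>C A y"
    then have "cinner x x *\<^sub>C (norm y)\<^sup>2 *\<^sub>R x = cinner x x *\<^sub>C A y" by blast
    then show "A y = (norm y)\<^sup>2 *\<^sub>R x"
      using assms by (simp only: complex_vector.scale_cancel_left cinner_self_eq_0) simp
  qed simp
  finally show ?thesis
    unfolding star_le_iff using 1 by blast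
qed

subsection \<open>Singular vectors\<close>

text \<open>For \<open>a > 0\<close> the nonzero elements are the right singular vectors with
  singular value \<open>a\<close>. Indexing by \<open>a\<close> rather than by the eigenvalue
  matches the coefficients of the decomposition.\<close>

definition sing_space :: "'a::complex_hilbert bop \<Rightarrow> real \<Rightarrow> 'a set" where
  "sing_space A a = {y. bop_adj A (A y) = a\<^sup>2 *\<^sub>R y}"

definition sing_support :: "'a::complex_hilbert bop \<Rightarrow> 'a set" where
  "sing_support A = closure (complex_vector.span (\<Union>a\<in>{0<..}. sing_space A a))"

abbreviation support_proj :: "'a::complex_hilbert bop \<Rightarrow> 'a bop" where
  "support_proj A \<equiv> projection (sing_support A)"

interpretation sing_space: closed_subspace "sing_space A a" for A :: "'a::complex_hilbert bop" and a
proof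
  show "complex_vector.subspace (sing_space A a)"
    unfolding sing_space_def
    by (rule complex_vector.subspaceI)
      (simp_all add: bop_add bop_scaleC scaleR_add_right scaleC_scaleR_commute)
  show "closed (sing_space A a)"
    unfolding sing_space_def
    by (intro closed_Collect_eq linear_continuous_on bounded_linear_compose[OF bounded_linear_bop]
        bounded_linear_bop bounded_linear_scaleR_right)
qed

interpretation sing_support: closed_subspace "sing_support A" for A :: "'a::complex_hilbert bop"
  by standard (simp_all add: sing_support_def subspace_closure_span)

lemma sing_space_subset_support: "a > 0 \<Longrightarrow> y \<in> sing_space A a \<Longrightarrow> y \<in> sing_support A"
  unfolding sing_support_def
  by (rule subsetD[OF closure_subset], rule complex_vector.span_base) auto

text \<open>The induction principle for the support. It is mostly applied to the set where two
  bounded operators agree, which is a closed subspace.\<close>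

lemma sing_support_minimal:
  assumes "complex_vector.subspace S" "closed S"
    and "\<And>a y. a > 0 \<Longrightarrow> y \<in> sing_space A a \<Longrightarrow> y \<in> S" and "y \<in> sing_support A"
  shows "y \<in> S"
  by (rule closure_span_minimal[OF assms(1,2) _ assms(4)[unfolded sing_support_def]])
    (use assms(3) in auto)

lemma support_proj_eq_0:
  assumes "\<And>a y. a > 0 \<Longrightarrow> y \<in> sing_space A a \<Longrightarrow> cinner z y = 0"
  shows "support_proj A z = 0"
proof (rule sing_support.projection_eq_0)
  fix s assume s: "s \<in> sing_support A"
  have "s \<in> {s. cinner s z = 0}"
    by (rule sing_support_minimal[OF subspace_cinner_eq_0 closed_cinner_eq_0 _ s])
      (use assms cinner_eq_0_sym in auto)
  then show "cinner z s = 0"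
    by (simp add: cinner_eq_0_sym)
qed

text \<open>\<open>cinner (A y) (A y) = cinner y (bop_adj A (A y))\<close>. So \<open>A\<close> is a
  multiple of an isometry on each eigenspace.\<close>

lemma norm_apply_sing_space:
  assumes "a > 0" "y \<in> sing_space A a"
  shows "norm (A y) = a * norm y"
proof -
  have "complex_of_real ((norm (A y))\<^sup>2) = cinner y (a\<^sup>2 *\<^sub>R y)"
    using assms(2) by (simp only: cinner_self[symmetric] cinner_adj) (simp add: sing_space_def)
  also have "\<dots> = complex_of_real ((a * norm y)\<^sup>2)"
    by (simp add: cinner_scaleR_right cinner_self power_mult_distrib)
  finally show ?thesis
    using assms(1) by (simp only: of_real_eq_iff) (simp add: power2_eq_iff_nonneg)
qed

lemma rank1_star_le_imp_sing_space:
  assumes "x \<noteq> 0" "y \<noteq> 0" "x \<otimes> y \<preceq> A"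
  shows "y \<in> sing_space A (norm x * norm y)"
  using assms(3) unfolding rank1_star_le_iff[OF assms(1,2)] sing_space_def
  by (simp add: bop_scaleR power_mult_distrib mult.commute)

lemma sing_space_imp_rank1_star_le:
  assumes a: "a > 0" and y: "y \<in> sing_space A a" "y \<noteq> 0"
  obtains x where "x \<noteq> 0" "x \<otimes> y \<preceq> A"
proof -
  \<comment> \<open>Forced by \<open>A y = (norm y)\<^sup>2 *\<^sub>R x\<close>. Its norm is
    \<open>a / norm y\<close>, which turns the equation for \<open>bop_adj A x\<close> into the
    eigenvector equation.\<close>
  define x where "x = (1 / (norm y)\<^sup>2) *\<^sub>R A y"
  have n: "norm x = a / norm y"
    using y(2) norm_apply_sing_space[OF a y(1)] by (simp add: x_def power2_eq_square)
  then have x: "x \<noteq> 0"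
    using a y(2) by auto
  have "A y = (norm y)\<^sup>2 *\<^sub>R x"
    using y(2) by (simp add: x_def)
  moreover have "bop_adj A x = (norm x)\<^sup>2 *\<^sub>R y"
    using y unfolding n by (simp add: x_def bop_scaleR sing_space_def power_divide)
  ultimately have "x \<otimes> y \<preceq> A"
    using rank1_star_le_iff[OF x y(2)] by blast
  with x show ?thesis using that by blast
qed

section \<open>The two types in terms of singular vectors\<close>

lemma type2_iff: "A \<in> type2 \<longleftrightarrow> (\<forall>a>0. sing_space A a \<subseteq> {0})"
proof
  assume "A \<in> type2"
  then show "\<forall>a>0. sing_space A a \<subseteq> {0}"
    using sing_space_imp_rank1_star_le unfolding type2_def by blast
next
  assume *: "\<forall>a>0. sing_space A a \<subseteq> {0}"
  show "A \<in> type2"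
    unfolding type2_def
  proof clarsimp
    fix x y assume "x \<otimes> y \<preceq> A" "y \<noteq> 0" "x \<noteq> 0"
    then have "y \<in> sing_space A (norm x * norm y)" "norm x * norm y > 0"
      by (auto intro: rank1_star_le_imp_sing_space)
    with * \<open>y \<noteq> 0\<close> show False by blast
  qed
qed

text \<open>The adjoint of \<open>A P = A\<close> is the statement that the projection
  \<open>P\<close> fixes the range of \<open>bop_adj A\<close>.\<close>

lemma apply_support_proj_imp_range_adj:
  assumes "\<And>z. A (support_proj A z) = A z"
  shows "bop_adj A x \<in> sing_support A"
proof -
  let ?P = "support_proj A"
  have "cinner (?P (bop_adj A x)) z = cinner (bop_adj A x) z" for z
    using assms by (metis cinner_adj' sing_support.adj_projection)
  then have "?P (bop_adj A x) = bop_adj A x"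
    by (rule cinner_ext_left)
  then show ?thesis
    by (metis sing_support.projection_in)
qed

text \<open>\<open>A \<cdot> ?P\<close> is an upper bound of the rank-1 operators below
  \<open>A\<close>, so a supremum \<open>A\<close> lies below it. Conversely, every upper bound
  agrees with \<open>A\<close> on singular vectors, hence on the support, which contains the range
  of \<open>bop_adj A\<close> when \<open>A P = A\<close>.\<close>

lemma type1_iff: "A \<in> type1 \<longleftrightarrow> (\<forall>z. A (support_proj A z) = A z)"
proof
  let ?P = "support_proj A"
  assume A: "A \<in> type1"
  show "\<forall>z. A (?P z) = A z"
  proof (cases "A = 0")
    case False
    have "star_upper_bound {x \<otimes> y |x y. x \<noteq> 0 \<and> y \<noteq> 0 \<and> x \<otimes> y \<preceq> A} (A \<cdot> ?P)"
      unfolding star_upper_bound_def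
    proof clarify
      fix x y assume xy: "x \<noteq> 0" "y \<noteq> 0" "x \<otimes> y \<preceq> A"
      then have "?P y = y"
        by (intro sing_support.projection_ident sing_space_subset_support[OF _ rank1_star_le_imp_sing_space])
          simp_all
      with xy show "x \<otimes> y \<preceq> A \<cdot> ?P"
        by (simp add: rank1_star_le_iff bop_scaleR)
    qed
    with A False have "A \<preceq> A \<cdot> ?P"
      unfolding type1_def is_star_sup_def by blast
    then have "bop_adj A (A (z - ?P z)) = 0" for z
      by (simp add: star_le_iff bop_diff)
    then have "A (z - ?P z) = 0" for z
      using adj_apply_apply_eq_0 by blast
    then show ?thesis
      by (simp add: bop_diff)
  qed simp
next
  let ?P = "support_proj A"
  assume A: "\<forall>z. A (?P z) = A z"
  have "A \<preceq> B" if B: "star_upper_bound {x \<otimes> y |x y. x \<noteq> 0 \<and> y \<noteq> 0 \<and> x \<otimes> y \<preceq> A} B" for B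
  proof -
    \<comment> \<open>\<open>B\<close> and \<open>A\<close> satisfy the same two equations for
      \<open>x \<otimes> y\<close>, and \<open>A y\<close> is a multiple of
      \<open>x\<close>.\<close>
    have agree: "B y = A y \<and> bop_adj B (A y) = bop_adj A (A y)"
      if y: "a > 0" "y \<in> sing_space A a" for a y
    proof (cases "y = 0")
      case False
      then obtain x where x: "x \<noteq> 0" "x \<otimes> y \<preceq> A"
        using sing_space_imp_rank1_star_le[OF y] by blast
      with B False have "x \<otimes> y \<preceq> B"
        unfolding star_upper_bound_def by blast
      with x False show ?thesis
        by (simp add: rank1_star_le_iff bop_scaleR)
    qed simp
    have BA: "B y = A y" if "y \<in> sing_support A" for y
      using sing_support_minimal[OF subspace_Collect_bop_eq closed_Collect_bop_eq _ that, of B A] agree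
      by blast
    have "(bop_adj B \<cdot> A) y = (bop_adj A \<cdot> A) y" if "y \<in> sing_support A" for y
      using sing_support_minimal[OF subspace_Collect_bop_eq closed_Collect_bop_eq _ that,
          of "bop_adj B \<cdot> A" "bop_adj A \<cdot> A"] agree
      by simp
    then have "bop_adj B (A z) = bop_adj A (A z)" for z
      using A sing_support.projection_in by (metis bop_comp_apply)
    then have "bop_adj B \<cdot> A = bop_adj A \<cdot> A"
      by (simp add: bop_eq_iff)
    then have "bop_adj (bop_adj B \<cdot> A) = bop_adj (bop_adj A \<cdot> A)"
      by simp
    then have "bop_adj A (B z) = bop_adj A (A z)" for z
      by (simp add: bop_eq_iff)
    moreover have "B (bop_adj A x) = A (bop_adj A x)" for x
      by (rule BA, rule apply_support_proj_imp_range_adj) (use A in blast)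
    ultimately show ?thesis
      by (simp add: star_le_iff)
  qed
  then show "A \<in> type1"
    unfolding type1_def is_star_sup_def star_upper_bound_def by blast
qed

subsection \<open>The decomposition into parts of type 1 and type 2\<close>

text \<open>The self-adjoint operator \<open>bop_adj A \<cdot> A\<close> scales singular vectors, so
  it leaves the support invariant.\<close>

lemma support_proj_commute:
  "support_proj A (bop_adj A (A x)) = bop_adj A (A (support_proj A x))"
proof -
  define T where "T = bop_adj A \<cdot> A"
  have "T s \<in> sing_support A" if s: "s \<in> sing_support A" for s
  proof -
    \<comment> \<open>Invariance is rephrased as agreement of two operators, so that it need only be
      checked on singular vectors.\<close>
    have "s \<in> {s. (support_proj A \<cdot> T) s = T s}"
    proof (rule sing_support_minimal[OF subspace_Collect_bop_eq closed_Collect_bop_eq _ s])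
      fix a y assume y: "a > 0" "y \<in> sing_space A a"
      then have "support_proj A y = y"
        by (intro sing_support.projection_ident sing_space_subset_support)
      with y show "y \<in> {s. (support_proj A \<cdot> T) s = T s}"
        by (simp add: T_def sing_space_def bop_scaleR)
    qed
    then have "support_proj A (T s) = T s"
      by simp
    then show ?thesis
      using sing_support.projection_in[of A "T s"] by simp
  qed
  moreover have "bop_adj T = T"
    by (simp add: T_def)
  ultimately have "support_proj A (T x) = T (support_proj A x)"
    using sing_support.projection_commute by blast
  then show ?thesis
    by (simp add: T_def)
qed

lemma comp_support_proj_star_le: "A \<cdot> support_proj A \<preceq> A"
  by (simp add: star_le_iff support_proj_commute)

text \<open>Singular vectors of \<open>A\<close> are singular vectors of \<open>?B\<close> for the
  same value. So what is orthogonal to the support of \<open>?B\<close> is killed by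
  \<open>?P\<close>.\<close>

lemma comp_support_proj_type1: "A \<cdot> support_proj A \<in> type1"
  unfolding type1_iff
proof
  fix z
  let ?B = "A \<cdot> support_proj A" and ?P = "support_proj A"
  have sub: "y \<in> sing_space ?B a" if "a > 0" "y \<in> sing_space A a" for a y
  proof -
    have "?P y = y"
      using that by (intro sing_support.projection_ident sing_space_subset_support)
    with that show ?thesis
      by (simp add: sing_space_def bop_scaleR)
  qed
  have "?P (z - support_proj ?B z) = 0"
  proof (rule support_proj_eq_0)
    fix a y assume "a > 0" "y \<in> sing_space A a"
    then show "cinner (z - support_proj ?B z) y = 0"
      using sub sing_support.cinner_projection sing_space_subset_support by blast
  qed
  then show "?B (support_proj ?B z) = ?B z"
    by (simp add: bop_diff)
qed

text \<open>The eigenvector equation reads \<open>(1 - P) T (1 - P) y = a\<^sup>2 y\<close>, where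
  \<open>T\<close> is \<open>bop_adj A \<cdot> A\<close>. Applying \<open>P\<close> gives
  \<open>P y = 0\<close>; then \<open>y\<close> is a singular vector of \<open>A\<close>, so that
  \<open>y = P y = 0\<close>.\<close>

lemma diff_comp_support_proj_type2: "A - A \<cdot> support_proj A \<in> type2"
  unfolding type2_iff
proof safe
  fix a :: real and y assume a: "a > 0" and y: "y \<in> sing_space (A - A \<cdot> support_proj A) a"
  let ?P = "support_proj A" and ?T = "\<lambda>x. bop_adj A (A x)"
  have eq: "?T (y - ?P y) - ?P (?T (y - ?P y)) = a\<^sup>2 *\<^sub>R y"
    using y by (simp add: sing_space_def adj_diff bop_diff algebra_simps)
  have "?P (a\<^sup>2 *\<^sub>R y) = 0"
    unfolding eq[symmetric] by (simp only: bop_diff[of ?P] sing_support.projection_idem) simp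
  then have Py: "?P y = 0"
    using a by (simp add: bop_scaleR)
  then have "y \<in> sing_space A a"
    using eq by (simp add: sing_space_def support_proj_commute)
  then have "?P y = y"
    using a by (intro sing_support.projection_ident sing_space_subset_support)
  with Py show "y = 0" by simp
qed

section \<open>Uniqueness of the two parts\<close>

text \<open>By orthogonality the mixed terms vanish. For a singular vector \<open>y\<close> of
  \<open>C + D\<close>, the component \<open>bop_adj D (D y)\<close> is then an eigenvector for
  \<open>D\<close> or zero, and type 2 leaves only zero.\<close>

lemma sing_space_orthogonal_type2:
  assumes orth: "C \<bottom> D" and D: "D \<in> type2" and a: "a > 0"
  shows "sing_space (C + D) a = sing_space C a" "y \<in> sing_space C a \<Longrightarrow> D y = 0"
proof -
  note o = orthogonalD[OF orth]
  have T: "bop_adj (C + D) ((C + D) y) = bop_adj C (C y) + bop_adj D (D y)" for y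
    by (simp add: adj_add bop_add o)
  show D0: "D y = 0" if "y \<in> sing_space C a" for y
  proof -
    have "bop_adj C (C y) = a\<^sup>2 *\<^sub>R y"
      using that by (simp add: sing_space_def)
    then have "D (a\<^sup>2 *\<^sub>R y) = 0"
      using o(4)[of "C y"] by simp
    then show ?thesis
      using a by (simp add: bop_scaleR)
  qed
  show "sing_space (C + D) a = sing_space C a"
  proof safe
    fix y assume "y \<in> sing_space C a"
    then show "y \<in> sing_space (C + D) a"
      using D0[of y] T[of y] by (simp add: sing_space_def)
  next
    fix y assume "y \<in> sing_space (C + D) a"
    then have y: "bop_adj C (C y) + bop_adj D (D y) = a\<^sup>2 *\<^sub>R y"
      unfolding sing_space_def mem_Collect_eq T .
    have "bop_adj D (D (bop_adj C (C y) + bop_adj D (D y))) = bop_adj D (D (bop_adj D (D y)))"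
      by (simp add: bop_add o)
    then have "bop_adj D (D y) \<in> sing_space D a"
      unfolding y by (simp add: sing_space_def bop_scaleR)
    then have "bop_adj D (D y) = 0"
      using D a unfolding type2_iff by blast
    with y show "y \<in> sing_space C a"
      by (simp add: sing_space_def)
  qed
qed

text \<open>\<open>C\<close> and \<open>C + D\<close> have the same support projection
  \<open>P\<close>, with \<open>C P = C\<close> and \<open>D P = 0\<close>.\<close>

lemma type_decomposition_unique:
  fixes C D :: "'a::complex_hilbert bop"
  assumes C: "C \<in> type1" and D: "D \<in> type2" and orth: "C \<bottom> D"
  shows "C = (C + D) \<cdot> support_proj (C + D)"
proof (rule bop_eqI)
  fix z
  have supp: "sing_support (C + D) = sing_support C"
    unfolding sing_support_def using sing_space_orthogonal_type2(1)[OF orth D] by simp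
  have "D (support_proj C z) = (0 :: 'a bop) (support_proj C z)"
    using sing_support_minimal[OF subspace_Collect_bop_eq closed_Collect_bop_eq _
        sing_support.projection_in, of C D 0] sing_space_orthogonal_type2(2)[OF orth D]
    by simp
  then show "C z = ((C + D) \<cdot> support_proj (C + D)) z"
    using C by (simp add: supp type1_iff)
qed

subsection \<open>Orthogonal sums of projections\<close>

text \<open>A finite partial sum is the projection onto a larger and larger subspace, hence the best
  approximation from it, and every vector of the closed span is approximated by a vector of such a
  subspace.\<close>

lemma has_sum_projections:
  fixes S :: "'i \<Rightarrow> 'a::complex_hilbert set"
  assumes S: "\<And>i. i \<in> I \<Longrightarrow> closed_subspace (S i)"
    and orth: "\<And>i j x y. \<lbrakk>i \<in> I; j \<in> I; i \<noteq> j; x \<in> S i; y \<in> S j\<rbrakk> \<Longrightarrow> cinner x y = 0"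
  shows "((\<lambda>i. projection (S i) x) has_sum
    projection (closure (complex_vector.span (\<Union>i\<in>I. S i))) x) I"
proof -
  define E where "E = closure (complex_vector.span (\<Union>i\<in>I. S i))"
  define Q where "Q Y x = (\<Sum>i\<in>Y. projection (S i) x)" for Y x
  interpret E: closed_subspace E
    by standard (simp_all add: E_def subspace_closure_span)
  have SE: "y \<in> E" if "i \<in> I" "y \<in> S i" for i y
    unfolding E_def
    by (rule subsetD[OF closure_subset], rule complex_vector.span_base) (use that in auto)
  have proj_0: "projection (S i) y = 0" if "i \<in> I" "j \<in> I" "i \<noteq> j" "y \<in> S j" for i j y
    using closed_subspace.projection_eq_0[OF S] orth that by metis
  have Q_diff: "Q Y (x - y) = Q Y x - Q Y y" for Y x y
    by (simp add: Q_def bop_diff sum_subtractf)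
  have Q_proj: "Q Y (projection E x) = Q Y x" if "Y \<subseteq> I" for Y
    unfolding Q_def
  proof (rule sum.cong[OF refl])
    fix i assume "i \<in> Y"
    with that have i: "i \<in> I" by blast
    have "projection (S i) (x - projection E x) = 0"
      using closed_subspace.projection_eq_0[OF S[OF i]] E.cinner_projection SE[OF i] by blast
    then show "projection (S i) (projection E x) = projection (S i) x"
      by (simp add: bop_diff)
  qed
  \<comment> \<open>By Pythagoras, once \<open>w - Q Y w\<close> is known to be orthogonal to every
    summand of \<open>Q Y w\<close>.\<close>
  have Q_le: "norm (w - Q Y w) \<le> norm w" if Y: "finite Y" "Y \<subseteq> I" for Y w
  proof -
    have j: "cinner (projection (S j) w) (w - Q Y w) = 0" if "j \<in> Y" for j
    proof -
      interpret closed_subspace "S j"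
        using S that Y by blast
      have "cinner (Q Y w) (projection (S j) w) = (\<Sum>i\<in>Y. cinner (projection (S i) w) (projection (S j) w))"
        by (simp add: Q_def cinner_sum_left)
      also have "\<dots> = (\<Sum>i\<in>{j}. cinner (projection (S i) w) (projection (S j) w))"
      proof (intro sum.mono_neutral_right ballI)
        fix i assume "i \<in> Y - {j}"
        then have i: "i \<in> I" "i \<noteq> j"
          using Y by blast+
        with that Y show "cinner (projection (S i) w) (projection (S j) w) = 0"
          using orth[OF _ _ i(2) closed_subspace.projection_in[OF S[OF i(1)]] projection_in] by blast
      qed (use that Y in auto)
      also have "\<dots> = cinner w (projection (S j) w)"
        using cinner_projection[OF projection_in, of w w] by (simp add: cinner_diff_left)
      finally have "cinner (w - Q Y w) (projection (S j) w) = 0"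
        by (simp add: cinner_diff_left)
      then show ?thesis
        by (simp only: cinner_eq_0_sym)
    qed
    have "cinner (Q Y w) (w - Q Y w) = (\<Sum>j\<in>Y. cinner (projection (S j) w) (w - Q Y w))"
      by (subst Q_def, rule cinner_sum_left)
    also have "\<dots> = 0"
      using j by simp
    finally have "cinner (Q Y w) (w - Q Y w) = 0" .
    then have "(norm (Q Y w + (w - Q Y w)))\<^sup>2 = (norm (Q Y w))\<^sup>2 + (norm (w - Q Y w))\<^sup>2"
      by (simp only: norm_add_square) simp
    then have "(norm (w - Q Y w))\<^sup>2 \<le> (norm w)\<^sup>2"
      by simp
    then show ?thesis
      by (rule power2_le_imp_le) simp
  qed
  \<comment> \<open>A vector of the span involves finitely many \<open>S i\<close>; every
    \<open>Q Y\<close> with \<open>Y\<close> containing their indices fixes it.\<close>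
  have "\<exists>X. finite X \<and> X \<subseteq> I \<and> (\<forall>Y. finite Y \<and> X \<subseteq> Y \<and> Y \<subseteq> I \<longrightarrow> Q Y s = s)"
    if "s \<in> complex_vector.span (\<Union>i\<in>I. S i)" for s
    using that
  proof (induction rule: complex_vector.span_induct_alt)
    case base
    show ?case
      by (rule exI[of _ "{}"]) (simp add: Q_def)
  next
    case (step c y s)
    from step.IH obtain X where X: "finite X" "X \<subseteq> I"
        "\<And>Y. finite Y \<Longrightarrow> X \<subseteq> Y \<Longrightarrow> Y \<subseteq> I \<Longrightarrow> Q Y s = s"
      by metis
    from step.hyps obtain i where i: "i \<in> I" "y \<in> S i"
      by blast
    have "Q Y (c *\<^sub>C y + s) = c *\<^sub>C y + s" if Y: "finite Y" "insert i X \<subseteq> Y" "Y \<subseteq> I" for Y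
    proof -
      have "Q Y (c *\<^sub>C y) = (\<Sum>j\<in>{i}. projection (S j) (c *\<^sub>C y))"
        unfolding Q_def
      proof (intro sum.mono_neutral_right ballI)
        fix j assume "j \<in> Y - {i}"
        then have "projection (S j) y = 0"
          using Y(3) i by (intro proj_0[of j i]) blast+
        then show "projection (S j) (c *\<^sub>C y) = 0"
          by (simp add: bop_scaleC)
      qed (use Y in auto)
      then have "Q Y (c *\<^sub>C y) = c *\<^sub>C y"
        using closed_subspace.projection_ident[OF S i(2)] i(1) by (simp add: bop_scaleC)
      moreover have "Q Y (c *\<^sub>C y + s) = Q Y (c *\<^sub>C y) + Q Y s"
        by (simp add: Q_def bop_add sum.distrib)
      ultimately show ?thesis
        using X(3) Y by simp
    qed
    then show ?case
      using X i by (intro exI[of _ "insert i X"]) auto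
  qed
  note span_fixed = this
  have "\<exists>X. finite X \<and> X \<subseteq> I \<and>
      (\<forall>Y. finite Y \<and> X \<subseteq> Y \<and> Y \<subseteq> I \<longrightarrow> dist (Q Y x) (projection E x) < e)"
    if "e > 0" for e
  proof -
    obtain s where s: "s \<in> complex_vector.span (\<Union>i\<in>I. S i)" "dist s (projection E x) < e"
      using E.projection_in[of x] \<open>e > 0\<close> unfolding E_def closure_approachable by blast
    obtain X where X: "finite X" "X \<subseteq> I" "\<And>Y. finite Y \<Longrightarrow> X \<subseteq> Y \<Longrightarrow> Y \<subseteq> I \<Longrightarrow> Q Y s = s"
      using span_fixed[OF s(1)] by metis
    have "dist (Q Y x) (projection E x) < e" if Y: "finite Y" "X \<subseteq> Y" "Y \<subseteq> I" for Y
    proof -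
      let ?w = "projection E x - s"
      \<comment> \<open>\<open>Q Y\<close> fixes \<open>s\<close> and does not see the component of
        \<open>x\<close> orthogonal to \<open>E\<close>, so the error at \<open>x\<close> equals the
        error at \<open>?w\<close>.\<close>
      have "?w - Q Y ?w = projection E x - Q Y x"
        using X(3)[OF Y] Q_proj[OF Y(3)] by (simp add: Q_diff)
      then have "norm (projection E x - Q Y x) \<le> norm ?w"
        using Q_le[OF Y(1,3), of ?w] by (simp only:)
      then show ?thesis
        using s(2) by (simp add: dist_norm norm_minus_commute)
    qed
    then show ?thesis
      using X(1,2) by (intro exI[of _ X]) simp
  qed
  then have "((\<lambda>i. projection (S i) x) has_sum projection E x) I"
    by (simp add: has_sum_def tendsto_iff eventually_finite_subsets_at_top Q_def)
  then show ?thesis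
    by (simp add: E_def)
qed

text \<open>Eigenvectors of a self-adjoint operator for different eigenvalues; positivity separates
  the squares.\<close>

lemma sing_space_orthogonal:
  assumes "0 < a" "0 < b" "a \<noteq> b" and x: "x \<in> sing_space A a" and y: "y \<in> sing_space A b"
  shows "cinner x y = 0"
proof -
  have "cinner (a\<^sup>2 *\<^sub>R x) y = cinner (bop_adj A (A x)) y"
    using x by (simp add: sing_space_def)
  also have "\<dots> = cinner x (bop_adj A (A y))"
    by (simp add: cinner_adj)
  also have "\<dots> = cinner x (b\<^sup>2 *\<^sub>R y)"
    using y by (simp add: sing_space_def)
  finally have "(complex_of_real (a\<^sup>2) - complex_of_real (b\<^sup>2)) * cinner x y = 0"
    by (simp add: cinner_scaleR_left cinner_scaleR_right algebra_simps)
  moreover have "complex_of_real (a\<^sup>2) \<noteq> complex_of_real (b\<^sup>2)"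
    using assms(1-3) by (simp only: of_real_eq_iff) (simp add: power2_eq_iff_nonneg)
  ultimately show ?thesis
    by (simp only: mult_eq_0_iff eq_iff_diff_eq_0[symmetric]) blast
qed

subsection \<open>The decomposition into multiples of partial isometries\<close>

definition sing_vals :: "'a::complex_hilbert bop \<Rightarrow> real set" where
  "sing_vals A = {a. a > 0 \<and> (\<exists>y\<in>sing_space A a. y \<noteq> 0)}"

definition sing_part :: "'a::complex_hilbert bop \<Rightarrow> real \<Rightarrow> 'a bop" where
  "sing_part A a = bop_scaleR (1 / a) (A \<cdot> projection (sing_space A a))"

lemma sing_part_apply: "sing_part A a x = (1 / a) *\<^sub>R A (projection (sing_space A a) x)"
  by (simp add: sing_part_def)

lemma adj_sing_part_apply:
  "bop_adj (sing_part A a) x = (1 / a) *\<^sub>R projection (sing_space A a) (bop_adj A x)"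
  by (simp add: sing_part_def)

text \<open>The kernel contains the complement of the eigenspace, so a vector orthogonal to the
  kernel lies in the eigenspace.\<close>

lemma partial_isometry_sing_part:
  assumes a: "a > 0"
  shows "partial_isometry (sing_part A a)"
  unfolding partial_isometry_def
proof (intro allI impI)
  fix x assume *: "\<forall>y. sing_part A a y = 0 \<longrightarrow> cinner x y = 0"
  let ?P = "projection (sing_space A a)"
  have "sing_part A a (x - ?P x) = 0"
    by (simp add: sing_part_apply bop_diff)
  then have "cinner x (x - ?P x) = 0"
    using * by blast
  moreover have "cinner (?P x) (x - ?P x) = 0"
    using sing_space.cinner_projection sing_space.projection_in cinner_eq_0_sym by blast
  ultimately have "cinner (x - ?P x) (x - ?P x) = 0"
    by (simp only: cinner_diff_left) simp
  then have "?P x = x"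
    by simp
  then show "norm (sing_part A a x) = norm x"
    using a norm_apply_sing_space[OF a, of x A] sing_space.projection_in[of A a x]
    by (simp add: sing_part_apply)
qed

text \<open>Both products reduce to the product of two orthogonal projections, the first because
  \<open>bop_adj A \<cdot> A\<close> is scalar on the eigenspace for \<open>b\<close>.\<close>

lemma sing_part_orthogonal:
  assumes "0 < a" "0 < b" "a \<noteq> b"
  shows "sing_part A a \<bottom> sing_part A b"
proof -
  have PP: "projection (sing_space A a) y = 0" if "y \<in> sing_space A b" for y
    using sing_space_orthogonal[of b a y A] assms that by (intro sing_space.projection_eq_0) simp
  have T: "bop_adj A (A y) = b\<^sup>2 *\<^sub>R y" if "y \<in> sing_space A b" for y
    using that by (simp add: sing_space_def)
  show ?thesis
    by (simp add: bop_orthogonal_def bop_eq_iff sing_part_apply adj_sing_part_apply bop_scaleR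
        T PP sing_space.projection_in)
qed

text \<open>\<open>A\<close> is applied to the expansion of its support projection, and indices with
  trivial eigenspace are dropped.\<close>

lemma has_sum_sing_part:
  assumes "A \<in> type1"
  shows "((\<lambda>a. a *\<^sub>R sing_part A a x) has_sum A x) (sing_vals A)"
proof -
  have "((\<lambda>a. projection (sing_space A a) x) has_sum support_proj A x) {0<..}"
    unfolding sing_support_def
  proof (rule has_sum_projections)
    show "closed_subspace (sing_space A a)" for a ..
  qed (use sing_space_orthogonal in auto)
  then have "((\<lambda>a. A (projection (sing_space A a) x)) has_sum A (support_proj A x)) {0<..}"
    by (rule has_sum_bounded_linear[OF bounded_linear_bop])
  also have "A (support_proj A x) = A x"
    using assms by (simp add: type1_iff)
  also have "((\<lambda>a. A (projection (sing_space A a) x)) has_sum A x) {0<..} \<longleftrightarrow> ?thesis"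
  proof (rule has_sum_cong_neutral)
    fix a assume "a \<in> {0<..} - sing_vals A"
    then have "projection (sing_space A a) x = 0"
      using sing_space.projection_in[of A a x] unfolding sing_vals_def by auto
    then show "A (projection (sing_space A a) x) = 0" by simp
  qed (auto simp: sing_vals_def sing_part_apply)
  finally show ?thesis .
qed

lemma isometry_decomposition_sing_part:
  assumes "A \<in> type1"
  shows "isometry_decomposition A (sing_vals A) (sing_part A) (\<lambda>a. a)"
  unfolding isometry_decomposition_def
proof (intro conjI ballI allI impI)
  show "((\<lambda>a. a *\<^sub>R sing_part A a x) has_sum A x) (sing_vals A)" for x
    by (rule has_sum_sing_part[OF assms])
  fix a assume "a \<in> sing_vals A"
  then obtain y where a: "a > 0" and y: "y \<in> sing_space A a" "y \<noteq> 0"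
    by (auto simp: sing_vals_def)
  show "a > 0" by fact
  show "partial_isometry (sing_part A a)"
    by (rule partial_isometry_sing_part[OF a])
  have "A y \<noteq> 0"
    using norm_apply_sing_space[OF a y(1)] a y(2) by auto
  then have "sing_part A a y \<noteq> 0"
    using a y by (simp add: sing_part_apply sing_space.projection_ident)
  then show "sing_part A a \<noteq> 0"
    by auto
qed (auto simp: sing_vals_def intro: sing_part_orthogonal)

subsection \<open>Uniqueness of the decomposition\<close>

text \<open>For \<open>z\<close> in the range of \<open>U\<^sup>*\<close>, \<open>\<parallel>U\<^sup>* U z - z\<parallel>\<^sup>2 = \<parallel>U\<^sup>* U z\<parallel>\<^sup>2 - \<parallel>z\<parallel>\<^sup>2\<close>, which is at most \<open>0\<close>
  because \<open>U\<^sup>*\<close> is a contraction.\<close>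

lemma partial_isometry_adj:
  fixes U :: "'a::complex_hilbert bop"
  assumes U: "partial_isometry U"
  shows "bop_adj U (U (bop_adj U w)) = bop_adj U w"
proof -
  \<comment> \<open>The kernel is written as agreement with the zero operator, so that the general
    closedness lemma applies.\<close>
  interpret ker: closed_subspace "{x. U x = (0 :: 'a bop) x}"
    by standard (rule subspace_Collect_bop_eq closed_Collect_bop_eq)+
  have iso: "norm (U x) = norm x" if "\<And>y. U y = 0 \<Longrightarrow> cinner x y = 0" for x
    using U that unfolding partial_isometry_def by blast
  have contr: "norm (U x) \<le> norm x" for x
  proof -
    define n where "n = projection {x. U x = (0 :: 'a bop) x} x"
    have n: "U n = 0" "\<And>y. U y = 0 \<Longrightarrow> cinner (x - n) y = 0"
      using ker.projection_in[of x] ker.cinner_projection[of _ x] by (simp_all add: n_def)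
    have "norm (U x) = norm (x - n)"
      using iso[of "x - n"] n by (simp add: bop_diff)
    moreover have "(norm ((x - n) + n))\<^sup>2 = (norm (x - n))\<^sup>2 + (norm n)\<^sup>2"
      using n by (simp only: norm_add_square) simp
    then have "(norm (x - n))\<^sup>2 \<le> (norm x)\<^sup>2"
      by simp
    then have "norm (x - n) \<le> norm x"
      by (rule power2_le_imp_le) simp
    ultimately show ?thesis by simp
  qed
  have contr_adj: "norm (bop_adj U v) \<le> norm v" for v
  proof (cases "bop_adj U v = 0")
    case False
    have "norm (bop_adj U v) * norm (bop_adj U v) = cmod (cinner (bop_adj U v) (bop_adj U v))"
      by (simp add: cinner_self power2_eq_square norm_mult)
    also have "\<dots> = cmod (cinner (U (bop_adj U v)) v)"
      by (simp add: cinner_adj)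
    also have "\<dots> \<le> norm (U (bop_adj U v)) * norm v"
      by (rule cinner_Cauchy_Schwarz)
    also have "\<dots> \<le> norm (bop_adj U v) * norm v"
      by (rule mult_right_mono[OF contr]) simp
    finally show ?thesis
      using False by simp
  qed simp
  define z where "z = bop_adj U w"
  have z: "norm (U z) = norm z"
  proof (rule iso)
    show "cinner z y = 0" if "U y = 0" for y
      using that by (simp add: z_def flip: cinner_adj')
  qed
  have "cinner (bop_adj U (U z)) z = cinner (U z) (U z)"
    by (simp add: cinner_adj')
  then have "(norm (bop_adj U (U z) - z))\<^sup>2
      = (norm (bop_adj U (U z)))\<^sup>2 - 2 * (norm (U z))\<^sup>2 + (norm z)\<^sup>2"
    by (simp add: norm_diff_square cinner_self del: of_real_power)
  also have "\<dots> \<le> 0"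
    using power_mono[OF contr_adj[of "U z"] norm_ge_zero, of 2] z by simp
  finally show ?thesis
    by (simp add: z_def)
qed

context
  fixes A :: "'a::complex_hilbert bop" and K :: "'k set" and V :: "'k \<Rightarrow> 'a bop" and b :: "'k \<Rightarrow> real"
  assumes dec: "isometry_decomposition A K V b"
begin

lemma decomposition_pos: "k \<in> K \<Longrightarrow> b k > 0"
  and decomposition_nonzero: "k \<in> K \<Longrightarrow> V k \<noteq> 0"
  and decomposition_isometry: "k \<in> K \<Longrightarrow> partial_isometry (V k)"
  and decomposition_orthogonal: "k \<in> K \<Longrightarrow> l \<in> K \<Longrightarrow> k \<noteq> l \<Longrightarrow> V k \<bottom> V l"
  and decomposition_inj: "inj_on b K"
  and decomposition_has_sum: "((\<lambda>k. b k *\<^sub>R V k x) has_sum A x) K"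
  using dec by (auto simp: isometry_decomposition_def inj_on_def)

lemma decomposition_apply_single:
  assumes k: "k \<in> K" and "\<And>l. l \<in> K \<Longrightarrow> l \<noteq> k \<Longrightarrow> V l x = 0"
  shows "A x = b k *\<^sub>R V k x"
proof (rule has_sum_unique[OF decomposition_has_sum])
  show "((\<lambda>k. b k *\<^sub>R V k x) has_sum b k *\<^sub>R V k x) K"
    by (rule has_sum_finite_neutralI[of "{k}"]) (use assms in auto)
qed

lemma adj_decomposition_apply:
  assumes k: "k \<in> K"
  shows "bop_adj (V k) (A x) = b k *\<^sub>R bop_adj (V k) (V k x)"
proof (rule has_sum_unique)
  show "((\<lambda>l. bop_adj (V k) (b l *\<^sub>R V l x)) has_sum bop_adj (V k) (A x)) K"
    by (rule has_sum_bounded_linear[OF bounded_linear_bop decomposition_has_sum])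
  show "((\<lambda>l. bop_adj (V k) (b l *\<^sub>R V l x)) has_sum b k *\<^sub>R bop_adj (V k) (V k x)) K"
    by (rule has_sum_finite_neutralI[of "{k}"])
      (use k orthogonalD(1)[OF decomposition_orthogonal] in \<open>auto simp: bop_scaleR\<close>)
qed

text \<open>The adjoint of the preceding identity, whose right side is self-adjoint. This avoids
  taking adjoints inside the strongly convergent sum.\<close>

lemma adj_apply_decomposition:
  assumes k: "k \<in> K"
  shows "bop_adj A (V k w) = b k *\<^sub>R bop_adj (V k) (V k w)"
  by (rule cinner_ext_left)
    (simp add: cinner_adj cinner_scaleR_left cinner_scaleR_right adj_decomposition_apply[OF k])

text \<open>On this range only the \<open>k\<close>-th term of the sum survives, and
  \<open>bop_adj (V k) \<cdot> V k\<close> acts as the identity there.\<close>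

lemma range_adj_decomposition:
  assumes k: "k \<in> K"
  shows "bop_adj (V k) w \<in> sing_space A (b k)"
proof -
  have "A (bop_adj (V k) w) = b k *\<^sub>R V k (bop_adj (V k) w)"
    by (rule decomposition_apply_single[OF k])
      (use k orthogonalD(2)[OF decomposition_orthogonal] in blast)
  then show ?thesis
    by (simp add: sing_space_def bop_scaleR adj_apply_decomposition[OF k]
        partial_isometry_adj[OF decomposition_isometry[OF k]] power2_eq_square)
qed

text \<open>\<open>cinner (V k x) (V k x)\<close> pairs \<open>x\<close> with a vector in the range
  of \<open>bop_adj (V k)\<close>, hence in the eigenspace.\<close>

lemma decomposition_apply_eq_0:
  assumes k: "k \<in> K" and x: "\<And>y. y \<in> sing_space A (b k) \<Longrightarrow> cinner x y = 0"
  shows "V k x = 0"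
proof -
  have "cinner (V k x) (V k x) = 0"
    unfolding cinner_adj by (rule x, rule range_adj_decomposition[OF k])
  then show ?thesis by simp
qed

lemma decomposition_apply_sing_space:
  assumes k: "k \<in> K" and y: "y \<in> sing_space A (b k)"
  shows "A y = b k *\<^sub>R V k y"
proof (rule decomposition_apply_single[OF k])
  fix l assume l: "l \<in> K" "l \<noteq> k"
  then have "b k \<noteq> b l"
    using k decomposition_inj by (auto simp: inj_on_def)
  then show "V l y = 0"
    using sing_space_orthogonal decomposition_pos k l y by (intro decomposition_apply_eq_0) blast+
qed

text \<open>Every term of the sum kills the complement of the support, so \<open>A\<close> does
  too.\<close>

lemma decomposition_type1: "A \<in> type1"
  unfolding type1_iff
proof
  fix z
  have "V k (z - support_proj A z) = 0" if k: "k \<in> K" for k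
    by (rule decomposition_apply_eq_0[OF k], rule sing_support.cinner_projection,
        rule sing_space_subset_support[OF decomposition_pos[OF k]])
  then have "((\<lambda>k. b k *\<^sub>R V k (z - support_proj A z)) has_sum 0) K"
    by (intro has_sum_0) simp
  then have "A (z - support_proj A z) = 0"
    by (rule has_sum_unique[OF decomposition_has_sum])
  then show "A (support_proj A z) = A z"
    by (simp add: bop_diff)
qed

text \<open>Both sides vanish on the complement of the eigenspace, and on the eigenspace only the
  \<open>k\<close>-th term contributes to \<open>A\<close>.\<close>

lemma decomposition_eq_sing_part:
  assumes k: "k \<in> K"
  shows "V k = sing_part A (b k)"
proof (rule bop_eqI)
  fix x
  let ?P = "projection (sing_space A (b k))"
  have "V k (x - ?P x) = 0"
    by (rule decomposition_apply_eq_0[OF k], rule sing_space.cinner_projection)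
  moreover have "A (?P x) = b k *\<^sub>R V k (?P x)"
    by (rule decomposition_apply_sing_space[OF k sing_space.projection_in])
  ultimately show "V k x = sing_part A (b k) x"
    using decomposition_pos[OF k] by (simp add: sing_part_apply bop_diff)
qed

lemma decomposition_image_eq_sing_vals: "b ` K = sing_vals A"
proof (intro equalityI subsetI)
  fix a assume "a \<in> b ` K"
  then obtain k where k: "k \<in> K" and a: "a = b k" by blast
  have "bop_adj (V k) \<noteq> 0"
    using decomposition_nonzero[OF k] by simp
  then obtain w where "bop_adj (V k) w \<noteq> 0"
    by (auto simp: bop_eq_iff)
  then show "a \<in> sing_vals A"
    using range_adj_decomposition[OF k] decomposition_pos[OF k] unfolding a sing_vals_def by blast
next
  fix a assume "a \<in> sing_vals A"
  then obtain y where a: "a > 0" and y: "y \<in> sing_space A a" "y \<noteq> 0"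
    by (auto simp: sing_vals_def)
  show "a \<in> b ` K"
  proof (rule ccontr)
    assume "a \<notin> b ` K"
    \<comment> \<open>A singular value missed by \<open>b\<close> makes \<open>y\<close> orthogonal
      to all eigenspaces for values of \<open>b\<close>, so \<open>A y = 0\<close> although
      \<open>norm (A y) = a * norm y\<close>.\<close>
    then have "V k y = 0" if "k \<in> K" for k
      using sing_space_orthogonal[OF a decomposition_pos _ y(1)] that
      by (intro decomposition_apply_eq_0) blast+
    then have "((\<lambda>k. b k *\<^sub>R V k y) has_sum 0) K"
      by (intro has_sum_0) simp
    then have "A y = 0"
      by (rule has_sum_unique[OF decomposition_has_sum])
    then show False
      using norm_apply_sing_space[OF a y(1)] a y(2) by simp
  qed
qed

lemma decomposition_reindex:
  "\<exists>\<pi>. bij_betw \<pi> (sing_vals A) K \<and> (\<forall>a\<in>sing_vals A. V (\<pi> a) = sing_part A a \<and> b (\<pi> a) = a)"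
proof (intro exI conjI ballI)
  have "bij_betw b K (sing_vals A)"
    using decomposition_inj decomposition_image_eq_sing_vals by (simp add: bij_betw_def)
  then show "bij_betw (inv_into K b) (sing_vals A) K"
    by (rule bij_betw_inv_into)
  fix a assume "a \<in> sing_vals A"
  then have a: "a \<in> b ` K"
    by (simp add: decomposition_image_eq_sing_vals)
  show "b (inv_into K b a) = a"
    using a by (rule f_inv_into_f)
  then show "V (inv_into K b a) = sing_part A a"
    using decomposition_eq_sing_part[OF inv_into_into[OF a]] by simp
qed

end

theorem theorem2p4:
  fixes A :: "'a::complex_hilbert bop"
  assumes "infinite_dimensional TYPE('a)"
  shows "(\<exists>!(A\<^sub>1, A\<^sub>2). A\<^sub>1 \<in> type1 \<and> A\<^sub>2 \<in> type2 \<and> A\<^sub>1 \<preceq> A \<and> A\<^sub>2 \<preceq> A \<and> A = A\<^sub>1 + A\<^sub>2) \<and>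
    (A \<in> type1 \<longleftrightarrow>
      (\<exists>(J::real set) U a. isometry_decomposition A J U a \<and>
        (\<forall>(K::'k set) V b. isometry_decomposition A K V b \<longrightarrow>
          (\<exists>\<pi>. bij_betw \<pi> J K \<and> (\<forall>j\<in>J. V (\<pi> j) = U j \<and> b (\<pi> j) = a j)))))"
proof (intro conjI iffI)
  let ?A1 = "A \<cdot> support_proj A"
  show "\<exists>!(A\<^sub>1, A\<^sub>2). A\<^sub>1 \<in> type1 \<and> A\<^sub>2 \<in> type2 \<and> A\<^sub>1 \<preceq> A \<and> A\<^sub>2 \<preceq> A \<and> A = A\<^sub>1 + A\<^sub>2"
  proof (rule ex1I[of _ "(?A1, A - ?A1)"])
    show "case (?A1, A - ?A1) of (A\<^sub>1, A\<^sub>2) \<Rightarrow>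
        A\<^sub>1 \<in> type1 \<and> A\<^sub>2 \<in> type2 \<and> A\<^sub>1 \<preceq> A \<and> A\<^sub>2 \<preceq> A \<and> A = A\<^sub>1 + A\<^sub>2"
      using comp_support_proj_type1 diff_comp_support_proj_type2 comp_support_proj_star_le
      by (auto intro: star_le_diff)
  next
    fix p :: "'a bop \<times> 'a bop"
    assume "case p of (A\<^sub>1, A\<^sub>2) \<Rightarrow>
        A\<^sub>1 \<in> type1 \<and> A\<^sub>2 \<in> type2 \<and> A\<^sub>1 \<preceq> A \<and> A\<^sub>2 \<preceq> A \<and> A = A\<^sub>1 + A\<^sub>2"
    then obtain C D where p: "p = (C, D)" and CD: "C \<in> type1" "D \<in> type2" "C \<preceq> A" "A = C + D"
      by (cases p) auto
    then have "C \<bottom> D"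
      by (simp add: star_le_iff_orthogonal)
    with CD have "C = ?A1"
      using type_decomposition_unique by blast
    then show "p = (?A1, A - ?A1)"
      using CD(4) p by simp
  qed
next
  assume "A \<in> type1"
  then show "\<exists>(J::real set) U a. isometry_decomposition A J U a \<and>
      (\<forall>(K::'k set) V b. isometry_decomposition A K V b \<longrightarrow>
        (\<exists>\<pi>. bij_betw \<pi> J K \<and> (\<forall>j\<in>J. V (\<pi> j) = U j \<and> b (\<pi> j) = a j)))"
    \<comment> \<open>The witness is indexed by the singular values themselves; the inverse of
      \<open>b\<close> re-indexes any other decomposition.\<close>
    using isometry_decomposition_sing_part decomposition_reindex by blast
next
  assume "\<exists>(J::real set) U a. isometry_decomposition A J U a \<and>
      (\<forall>(K::'k set) V b. isometry_decomposition A K V b \<longrightarrow>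
        (\<exists>\<pi>. bij_betw \<pi> J K \<and> (\<forall>j\<in>J. V (\<pi> j) = U j \<and> b (\<pi> j) = a j)))"
  then show "A \<in> type1"
    using decomposition_type1 by blast
qed

end
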